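(* Let $Z$ be any topological space and let $Y$ be a $Z$-corecompact space. Then the topology $t_{1,s}^Z$ on $C(Y,Z)$ is admissible.
   Context: For a topological space $X$, $\mathcal{O}(X)$ denotes the family of all open subsets of $X$. $C(Y,Z)$ is the set of all continuous maps from $Y$ to $Z$, and $\mathcal{O}_Z(Y)=\{f^{-1}(U): f\in C(Y,Z),\ U\in\mathcal{O}(Z)\}$. $\tau_Y^Z$ is the topology on $Y$ having $\mathcal{O}_Z(Y)$ as a subbasis. A subset $K$ of a space $X$ is bounded (in $X$) if every open cover of $X$ has a finite subcollection covering $K$. The space $Y$ is $Z$-corecompact if for every $y\in Y$ and every open neighborhood $U$ of $y$ in $Y$ there is a neighborhood $f^{-1}(V)\in\mathcal{O}_Z(Y)$ of $y$ such that $f^{-1}(V)\subseteq U$ and $f^{-1}(V)$ is $Z$-bounded in the space $U$, meaning that $f^{-1}(V)$ is bounded in $U$ when $U$ carries the topology $\{U\cap W: W\in\tau_Y^Z\}$ (the subspace topology from $(Y,\tau_Y^Z)$). $\tau_{1,s}^Z$ is the family of all $\mathbb{H}\subseteq\mathcal{O}(Y)$ such that: ($\alpha$) if $A\in\mathbb{H}\cap\mathcal{O}_Z(Y)$, $V\in\mathcal{O}(Y)$ and $A\subseteq V$, then $V\in\mathbb{H}$; and ($\beta$) every collection of elements of $\mathcal{O}_Z(Y)$ whose union equals $Y$ has a finite subcollection whose union belongs to $\mathbb{H}$. The topology $t_{1,s}^Z$ on $C(Y,Z)$ has as a subbasis all sets $(\mathbb{H},U)=\{f\in C(Y,Z): f^{-1}(U)\in\mathbb{H}\}$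 with $\mathbb{H}\in\tau_{1,s}^Z$ and $U\in\mathcal{O}(Z)$. A topology $t$ on $C(Y,Z)$ is admissible if for every space $X$ and every map $G:X\to C(Y,Z)$, continuity of $G:X\to (C(Y,Z),t)$ implies continuity of $\widetilde{G}:X\times Y\to Z$, $\widetilde{G}(x,y)=G(x)(y)$; equivalently, the evaluation map $e:(C(Y,Z),t)\times Y\to Z$, $e(f,y)=f(y)$, is continuous. *)

theory Defs
  imports "HOL-Analysis.Analysis"
begin

text \<open>
  Spaces are abstract topologies on an arbitrary carrier \<open>topspace\<close>, so that empty spaces
  are covered. Elements of \<open>C(Y,Z)\<close> are HOL functions that are extensional (equal to
  \<open>undefined\<close> outside the carrier of \<open>Y\<close>), so that equality in \<open>C(Y,Z)\<close> is equality of maps.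
\<close>

definition cmaps :: "'a topology \<Rightarrow> 'b topology \<Rightarrow> ('a \<Rightarrow> 'b) set" where
  "cmaps Y Z = {f. continuous_map Y Z f} \<inter> extensional (topspace Y)"

definition preim :: "'a topology \<Rightarrow> ('a \<Rightarrow> 'b) \<Rightarrow> 'b set \<Rightarrow> 'a set" where
  "preim Y f U = {y \<in> topspace Y. f y \<in> U}"

definition opens_via :: "'b topology \<Rightarrow> 'a topology \<Rightarrow> 'a set set" where
  "opens_via Z Y = {preim Y f U | f U. f \<in> cmaps Y Z \<and> openin Z U}"

text \<open>
  The topology on the carrier \<open>X\<close> with subbasis \<open>\<S>\<close>. The empty intersection is \<open>X\<close>, so \<open>X\<close> is
  open even if \<open>\<S>\<close> does not cover it; \<open>topology_generated_by\<close> would shrink the carrier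
  to \<open>\<Union>\<S>\<close>, which differs if \<open>C(Y,Z)\<close> is empty.
\<close>

definition subbase_topology :: "'a set \<Rightarrow> 'a set set \<Rightarrow> 'a topology" where
  "subbase_topology X \<S> =
    topology (arbitrary union_of (finite intersection_of (\<lambda>S. S \<in> \<S>) relative_to X))"

definition tau :: "'b topology \<Rightarrow> 'a topology \<Rightarrow> 'a topology" where
  "tau Z Y = subbase_topology (topspace Y) (opens_via Z Y)"

definition bounded_in_space :: "'a topology \<Rightarrow> 'a set \<Rightarrow> bool" where
  "bounded_in_space X K \<longleftrightarrow> K \<subseteq> topspace X \<and>
    (\<forall>\<U>. (\<forall>U\<in>\<U>. openin X U) \<and> \<Union>\<U> = topspace X \<longrightarrow>
      (\<exists>\<F>. finite \<F> \<and> \<F> \<subseteq> \<U> \<and> K \<subseteq> \<Union>\<F>))"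

definition corecompact :: "'b topology \<Rightarrow> 'a topology \<Rightarrow> bool" where
  "corecompact Z Y \<longleftrightarrow>
    (\<forall>y U. openin Y U \<and> y \<in> U \<longrightarrow>
      (\<exists>B \<in> opens_via Z Y. y \<in> B \<and> B \<subseteq> U \<and>
        bounded_in_space (subtopology (tau Z Y) U) B))"

definition tau_1s :: "'b topology \<Rightarrow> 'a topology \<Rightarrow> 'a set set set" where
  "tau_1s Z Y = {H. H \<subseteq> {V. openin Y V} \<and>
    (\<forall>A V. A \<in> H \<inter> opens_via Z Y \<and> openin Y V \<and> A \<subseteq> V \<longrightarrow> V \<in> H) \<and>
    (\<forall>\<C>. \<C> \<subseteq> opens_via Z Y \<and> \<Union>\<C> = topspace Y \<longrightarrow>
      (\<exists>\<F>. finite \<F> \<and> \<F> \<subseteq> \<C> \<and> \<Union>\<F> \<in> H))}"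

definition t_1s :: "'b topology \<Rightarrow> 'a topology \<Rightarrow> ('a \<Rightarrow> 'b) topology" where
  "t_1s Z Y = subbase_topology (cmaps Y Z)
    {{f \<in> cmaps Y Z. preim Y f U \<in> H} | H U. H \<in> tau_1s Z Y \<and> openin Z U}"

text \<open>
  HOL cannot quantify over types inside a definition, so the type of points of the test
  space \<open>X\<close> is a parameter; the quantification over all spaces \<open>X\<close> is obtained by leaving it a type variable.
  The first conjunct says that \<open>t\<close> is a topology on \<open>C(Y,Z)\<close>.
\<close>

definition admissible ::
  "'x itself \<Rightarrow> 'a topology \<Rightarrow> 'b topology \<Rightarrow> ('a \<Rightarrow> 'b) topology \<Rightarrow> bool" where
  "admissible (_ :: 'x itself) Y Z t \<longleftrightarrow> topspace t = cmaps Y Z \<and>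
    (\<forall>(X :: 'x topology) (G :: 'x \<Rightarrow> 'a \<Rightarrow> 'b). continuous_map X t G \<longrightarrow>
      continuous_map (prod_topology X Y) Z (\<lambda>(x, y). G x y))"

lemma admissible_eval:
  fixes Y :: "'a topology" and Z :: "'b topology" and t :: "('a \<Rightarrow> 'b) topology"
  assumes "admissible TYPE('a \<Rightarrow> 'b) Y Z t"
  shows "continuous_map (prod_topology t Y) Z (\<lambda>(f, y). f y)"
proof -
  have "continuous_map t t (\<lambda>f :: 'a \<Rightarrow> 'b. f)"
    by simp
  with assms show ?thesis
    unfolding admissible_def by blast
qed

lemma eval_admissible:
  fixes Y :: "'a topology" and Z :: "'b topology"
  assumes "topspace t = cmaps Y Z"
    and "continuous_map (prod_topology t Y) Z (\<lambda>(f, y). f y)"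
  shows "admissible TYPE('x) Y Z t"
  unfolding admissible_def
proof (intro conjI allI impI)
  fix X :: "'x topology" and G
  assume G: "continuous_map X t G"
  have "continuous_map (prod_topology X Y) (prod_topology t Y) (\<lambda>p. (G (fst p), snd p))"
    using continuous_map_compose[OF continuous_map_fst G, of Y] continuous_map_snd[of X Y]
    by (simp add: continuous_map_pairedI o_def)
  from continuous_map_compose[OF this assms(2)]
  show "continuous_map (prod_topology X Y) Z (\<lambda>(x, y). G x y)"
    by (simp add: o_def case_prod_unfold)
qed (rule assms(1))

end

theory Submission
  imports Defs
begin

text \<open>
  Given a point \<open>(f, y)\<close> and an open \<open>W\<close> containing \<open>f y\<close>, pick \<open>B \<in> \<O>\<^sub>Z(Y)\<close> with
  \<open>y \<in> B \<subseteq> f\<^sup>-\<^sup>1(W)\<close> that is \<open>Z\<close>-bounded in \<open>f\<^sup>-\<^sup>1(W)\<close>. By boundedness every cover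
  of \<open>Y\<close> from \<open>\<O>\<^sub>Z(Y)\<close> has a finite part covering \<open>B\<close>, so the family \<open>\<H>\<close> of open supersets of
  \<open>B\<close> lies in \<open>\<tau>\<^sub>1\<^sub>,\<^sub>s\<^sup>Z\<close>, and evaluation maps \<open>(\<H>, W) \<times> B\<close> into \<open>W\<close>.
\<close>

text \<open>Members of \<open>\<S>\<close> need not be subsets of \<open>X\<close>, so only their
  traces on \<open>X\<close> are open.\<close>

lemma openin_subbase_topology_Int:
  assumes "S \<in> \<S>"
  shows "openin (subbase_topology X \<S>) (X \<inter> S)"
  unfolding subbase_topology_def openin_subbase
  by (intro arbitrary_union_of_inc relative_to_inc finite_intersection_of_inc assms)

lemma topspace_subbase_topology: "topspace (subbase_topology X \<S>) = X"
  unfolding subbase_topology_def by (rule topspace_subbase)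

lemma openin_opens_via:
  assumes "A \<in> opens_via Z Y"
  shows "openin Y A"
  using assms unfolding opens_via_def preim_def cmaps_def
  by (auto intro: openin_continuous_map_preimage)

lemma openin_tau_opens_via:
  assumes "A \<in> opens_via Z Y"
  shows "openin (tau Z Y) A"
  using openin_subbase_topology_Int[OF assms, of "topspace Y"]
    openin_subset[OF openin_opens_via[OF assms]]
  unfolding tau_def by (simp add: Int_absorb1)

text \<open>Closure under open supersets is immediate. For the covering condition, the traces on
  \<open>U\<close> of a cover of \<open>Y\<close> from \<open>opens_via Z Y\<close> form an open
  cover of \<open>U\<close> in the topology induced by \<open>tau Z Y\<close>, to which boundedness
  of \<open>B\<close> applies.\<close>

lemma open_supersets_in_tau_1s:
  assumes B: "bounded_in_space (subtopology (tau Z Y) U) B" and U: "U \<subseteq> topspace Y"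
  shows "{V. openin Y V \<and> B \<subseteq> V} \<in> tau_1s Z Y"
proof -
  have "\<exists>\<F>. finite \<F> \<and> \<F> \<subseteq> \<C> \<and> openin Y (\<Union>\<F>) \<and> B \<subseteq> \<Union>\<F>"
    if \<C>: "\<C> \<subseteq> opens_via Z Y" "\<Union>\<C> = topspace Y" for \<C>
  proof -
    let ?\<U> = "(\<lambda>C. U \<inter> C) ` \<C>"
    have "openin (subtopology (tau Z Y) U) V" if "V \<in> ?\<U>" for V
    proof -
      from that obtain C where "C \<in> \<C>" and V: "V = U \<inter> C"
        by blast
      then have "openin (tau Z Y) C"
        using \<C>(1) openin_tau_opens_via by blast
      then show ?thesis
        unfolding V by (rule openin_subtopology_Int2)
    qed
    moreover have "\<Union>?\<U> = topspace (subtopology (tau Z Y) U)"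
      using U \<C>(2) by (auto simp: tau_def topspace_subbase_topology)
    ultimately obtain \<G> where "finite \<G>" "\<G> \<subseteq> ?\<U>" "B \<subseteq> \<Union>\<G>"
      using B unfolding bounded_in_space_def by meson
    \<comment> \<open>Lift the chosen traces back to members of the cover; passing to these larger
      sets keeps \<open>B\<close> covered.\<close>
    moreover from this obtain \<F> where \<F>: "finite \<F>" "\<F> \<subseteq> \<C>" "\<G> = (\<lambda>C. U \<inter> C) ` \<F>"
      by (meson finite_subset_image)
    ultimately have "B \<subseteq> \<Union>\<F>"
      by blast
    moreover have "openin Y (\<Union>\<F>)"
      using \<F>(2) \<C>(1) openin_opens_via by (intro openin_Union) blast
    ultimately show ?thesis
      using \<F>(1,2) by blast
  qed
  then show ?thesis
    unfolding tau_1s_def by auto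
qed

theorem corollary2p10:
  fixes Y :: "'a topology" and Z :: "'b topology"
  assumes "corecompact Z Y"
  shows "admissible TYPE('x) Y Z (t_1s Z Y)"
proof (rule eval_admissible)
  let ?t = "t_1s Z Y" and ?e = "\<lambda>(f :: 'a \<Rightarrow> 'b, y). f y"
  show top: "topspace ?t = cmaps Y Z"
    unfolding t_1s_def by (rule topspace_subbase_topology)
  show "continuous_map (prod_topology ?t Y) Z ?e"
    unfolding continuous_map_def
  proof (intro conjI allI impI)
    show "?e \<in> topspace (prod_topology ?t Y) \<rightarrow> topspace Z"
      by (auto simp: top cmaps_def dest: continuous_map_funspace)
    fix W assume W: "openin Z W"
    let ?P = "{p \<in> topspace (prod_topology ?t Y). ?e p \<in> W}"
    have "\<exists>S T. openin ?t S \<and> openin Y T \<and> f \<in> S \<and> y \<in> T \<and> S \<times> T \<subseteq> ?P"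
      if "f \<in> cmaps Y Z" "y \<in> topspace Y" "f y \<in> W" for f y
    proof -
      define U where "U = preim Y f W"
      have "U \<in> opens_via Z Y"
        using that(1) W unfolding U_def opens_via_def by blast
      then have U: "openin Y U"
        by (rule openin_opens_via)
      moreover have "y \<in> U"
        using that by (simp add: U_def preim_def)
      ultimately obtain B where B: "B \<in> opens_via Z Y" "y \<in> B" "B \<subseteq> U"
          "bounded_in_space (subtopology (tau Z Y) U) B"
        using assms unfolding corecompact_def by blast
      define H where "H = {V. openin Y V \<and> B \<subseteq> V}"
      define S where "S = {g \<in> cmaps Y Z. preim Y g W \<in> H}"
      have "H \<in> tau_1s Z Y"
        unfolding H_def using B(4) openin_subset[OF U] by (rule open_supersets_in_tau_1s)
      then have "openin ?t (cmaps Y Z \<inter> S)"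
        unfolding t_1s_def S_def using W by (intro openin_subbase_topology_Int) blast
      then have "openin ?t S"
        by (simp add: S_def Int_absorb1)
      \<comment> \<open>Here \<open>preim Y f W\<close> is \<open>U\<close>, itself an open superset
        of \<open>B\<close>.\<close>
      moreover have "f \<in> S"
        using that(1) U B(3) by (simp add: S_def H_def U_def)
      moreover have "S \<times> B \<subseteq> ?P"
        by (auto simp: S_def H_def preim_def top)
      ultimately show ?thesis
        using B(2) openin_opens_via[OF B(1)] by blast
    qed
    then show "openin (prod_topology ?t Y) ?P"
      unfolding openin_prod_topology_alt by (auto simp: top)
  qed
qed

end
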